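(* Assume the combinatorial principle super stick (which is a consequence of CH). Then every $T_3$ topological space $X$ with property $C(\omega_1)$ satisfies $\operatorname{nw}(X)=\omega$.
   Context: Super stick is the statement: there is a family $\mathcal S\subset[\omega_1]^{<\omega_1}$ with $|\mathcal S|=\omega_1$ such that for every $I\in[\omega_1]^{\omega_1}$ there is $J\in[I]^{\omega_1}$ such that for every $T\in[J]^{<\omega_1}$ there is $S\in\mathcal S$ with $T\subset S\subset I$. A partial neighborhood assignment on a space $X$ is a function $U$ with $\operatorname{dom}(U)\subset X$ such that $U(y)$ is open in $X$ and $y\in U(y)$ for all $y\in\operatorname{dom}(U)$. $X$ has property $C(\omega_1)$, written $X\in C(\omega_1)$, iff for every partial neighborhood assignment $U$ on $X$ with $|\operatorname{dom}(U)|=\omega_1$ there is $Y\in[\operatorname{dom}(U)]^{\omega_1}$ with $Y\subset\bigcap_{y\in Y}U(y)$. A network of $X$ is a family $\mathcal N$ of subsets of $X$ such that for each open $G$ and $x\in G$ there is $N\in\mathcal N$ with $x\in N\subset G$. $\operatorname{nw}(X)$ is the minimal cardinality of a network of $X$ (cardinal functions are taken to be infinite, so $\operatorname{nw}(X)=\omega$ means that $X$ has a countable network). $T_3$ means regular and $T_1$ (hence Hausdorff). *)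

theory Defs
  imports "HOL-Analysis.Analysis" "HOL-Library.Countable_Set_Type"
begin

unbundle cardinal_syntax
no_notation elt_set_eq (infix \<open>=o\<close> 50) (* clashes with cardinal equality *)

text \<open>
  Cardinals are well-order relations as in \<^theory>\<open>HOL.BNF_Cardinal_Order_Relation\<close>. The first
  uncountable cardinal is the cardinal successor of \<^term>\<open>natLeq\<close>; as a set of ordinals it is
  represented by the field of this well-order.
\<close>

definition omega1 :: "nat set rel" where
  "omega1 = cardSuc natLeq"

text \<open>The families $[A]^{\kappa}$ and $[A]^{<\kappa}$.\<close>

definition subsets_eq :: "'a set \<Rightarrow> 'k rel \<Rightarrow> 'a set set" where
  "subsets_eq A \<kappa> = {B. B \<subseteq> A \<and> |B| =o \<kappa>}"

definition subsets_less :: "'a set \<Rightarrow> 'k rel \<Rightarrow> 'a set set" where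
  "subsets_less A \<kappa> = {B. B \<subseteq> A \<and> |B| <o \<kappa>}"

definition super_stick :: bool where
  "super_stick \<longleftrightarrow>
    (\<exists>\<S>. \<S> \<subseteq> subsets_less (Field omega1) omega1 \<and> |\<S>| =o omega1 \<and>
      (\<forall>I \<in> subsets_eq (Field omega1) omega1.
        \<exists>J \<in> subsets_eq I omega1.
          \<forall>T \<in> subsets_less J omega1. \<exists>S \<in> \<S>. T \<subseteq> S \<and> S \<subseteq> I))"

definition continuum_hypothesis :: bool where
  "continuum_hypothesis \<longleftrightarrow> |UNIV :: nat set set| =o omega1"

definition partial_nbhd_assignment :: "'a topology \<Rightarrow> ('a \<rightharpoonup> 'a set) \<Rightarrow> bool" where
  "partial_nbhd_assignment X U \<longleftrightarrow>
    dom U \<subseteq> topspace X \<and> (\<forall>y \<in> dom U. openin X (the (U y)) \<and> y \<in> the (U y))"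

definition C_omega1 :: "'a topology \<Rightarrow> bool" where
  "C_omega1 X \<longleftrightarrow>
    (\<forall>U. partial_nbhd_assignment X U \<and> |dom U| =o omega1 \<longrightarrow>
      (\<exists>Y \<in> subsets_eq (dom U) omega1. Y \<subseteq> (\<Inter>y\<in>Y. the (U y))))"

definition T3_space :: "'a topology \<Rightarrow> bool" where
  "T3_space X \<longleftrightarrow> regular_space X \<and> t1_space X"

definition network_of :: "'a topology \<Rightarrow> 'a set set \<Rightarrow> bool" where
  "network_of X \<N> \<longleftrightarrow>
    \<N> \<subseteq> Pow (topspace X) \<and>
    (\<forall>G x. openin X G \<and> x \<in> G \<longrightarrow> (\<exists>N \<in> \<N>. x \<in> N \<and> N \<subseteq> G))"

text \<open>
  The network weight is the least cardinality of a network, and is made infinite by adding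
  $\omega$: for cardinals, $\omega + \kappa = \max(\omega, \kappa)$. Like every cardinal here, it is
  meaningful only up to \<^term>\<open>ordIso\<close>.
\<close>

definition nw :: "'a topology \<Rightarrow> (nat + 'a set) rel" where
  "nw X = natLeq +c
    |SOME \<N>. network_of X \<N> \<and> (\<forall>\<N>'. network_of X \<N>' \<longrightarrow> |\<N>| \<le>o |\<N>'| )|"

lemma minimal_network_exists:
  "\<exists>\<N>. network_of X \<N> \<and> (\<forall>\<N>'. network_of X \<N>' \<longrightarrow> |\<N>| \<le>o |\<N>'| )"
proof -
  let ?R = "card_of ` {\<N>. network_of X \<N>}"
  have "network_of X (Pow (topspace X))"
    unfolding network_of_def
  proof (intro conjI subset_refl allI impI)
    fix G x assume "openin X G \<and> x \<in> G"
    then show "\<exists>N \<in> Pow (topspace X). x \<in> N \<and> N \<subseteq> G"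
      by (intro bexI[of _ G]) (simp_all add: openin_subset)
  qed
  then have "?R \<noteq> {}" by auto
  moreover have "\<forall>r \<in> ?R. Card_order r" by (simp add: card_of_Card_order)
  ultimately have "\<exists>r \<in> ?R. \<forall>r' \<in> ?R. r \<le>o r'"
    by (rule exists_minim_Card_order)
  then show ?thesis by simp
qed

lemma nw_eq_natLeq_iff:
  "nw X =o natLeq \<longleftrightarrow> (\<exists>\<N>. network_of X \<N> \<and> countable \<N>)"
proof -
  define \<M> where "\<M> = (SOME \<N>. network_of X \<N> \<and> (\<forall>\<N>'. network_of X \<N>' \<longrightarrow> |\<N>| \<le>o |\<N>'| ))"
  have \<M>: "network_of X \<M>" "\<And>\<N>. network_of X \<N> \<Longrightarrow> |\<M>| \<le>o |\<N>|"
    using someI_ex[OF minimal_network_exists[of X], folded \<M>_def] by simp_all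
  have nw: "nw X = natLeq +c |\<M>|"
    unfolding nw_def \<M>_def ..
  show ?thesis
  proof
    assume "nw X =o natLeq"
    then have "|\<M>| \<le>o natLeq"
      unfolding nw by (rule ordLeq_ordIso_trans[OF ordLeq_csum2[OF card_of_Card_order]])
    then show "\<exists>\<N>. network_of X \<N> \<and> countable \<N>"
      using \<M>(1) by (intro exI[of _ \<M>]) (simp add: countable_card_le_natLeq)
  next
    assume "\<exists>\<N>. network_of X \<N> \<and> countable \<N>"
    then obtain \<N> where "network_of X \<N>" "|\<N>| \<le>o natLeq"
      by (auto simp: countable_card_le_natLeq)
    have "|\<M>| \<le>o natLeq"
      by (rule ordLeq_transitive[OF \<M>(2)]) fact+
    then show "nw X =o natLeq"
      unfolding nw by (rule csum_absorb1[OF natLeq_Cinfinite])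
  qed
qed

end

theory Submission
  imports Defs
begin

text \<open>
  Under CH the family of all countable subsets of \<open>\<omega>\<^sub>1\<close> has size \<open>\<omega>\<^sub>1\<close>, and it witnesses super stick
  with \<open>J = I\<close> and \<open>S = T\<close>.

  Now let \<open>{S\<^sub>\<xi> : \<xi> < \<omega>\<^sub>1}\<close> witness super stick and suppose that \<open>X\<close> has no countable network.
  Choose recursively distinct points \<open>x\<^sub>\<alpha>\<close> with open neighbourhoods \<open>U\<^sub>\<alpha>\<close> such that
  \<open>x\<^sub>\<alpha> \<in> cl {x\<^sub>\<beta> : \<beta> \<in> S\<^sub>\<xi>} \<subseteq> U\<^sub>\<alpha>\<close> holds for no \<open>\<xi> < \<alpha>\<close> with \<open>S\<^sub>\<xi> \<subseteq> \<alpha>\<close>. Shrink \<open>U\<^sub>\<alpha>\<close> to \<open>V\<^sub>\<alpha>\<close> with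
  \<open>cl V\<^sub>\<alpha> \<subseteq> U\<^sub>\<alpha>\<close>. By \<open>C(\<omega>\<^sub>1)\<close> there is an uncountable \<open>I\<close> with \<open>x\<^sub>\<beta> \<in> V\<^sub>\<alpha>\<close> for all \<open>\<alpha>, \<beta> \<in> I\<close>. Take
  \<open>J \<subseteq> I\<close> from super stick, a countable \<open>T \<subseteq> J\<close> such that \<open>{x\<^sub>\<alpha> : \<alpha> \<in> T}\<close> is dense in
  \<open>{x\<^sub>\<alpha> : \<alpha> \<in> J}\<close>, and \<open>T \<subseteq> S\<^sub>\<xi> \<subseteq> I\<close>. Every sufficiently large \<open>\<alpha> \<in> J\<close> contradicts the choice of
  \<open>x\<^sub>\<alpha>\<close> and \<open>U\<^sub>\<alpha>\<close>.
\<close>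

section \<open>Countability and initial segments in \<open>omega1\<close>\<close>

lemma Card_order_omega1: "Card_order omega1"
  unfolding omega1_def by (rule cardSuc_Card_order[OF natLeq_Card_order])

lemma Well_order_omega1: "Well_order omega1"
  using Card_order_omega1 by (simp add: card_order_on_def)

lemma card_less_omega1_iff: "|A| <o omega1 \<longleftrightarrow> countable A"
  unfolding omega1_def countable_card_le_natLeq
  by (rule cardSuc_ordLeq_ordLess[OF natLeq_Card_order card_of_Card_order])

lemma uncountable_if_card_eq_omega1: "|A| =o omega1 \<Longrightarrow> uncountable A"
  using card_less_omega1_iff not_ordLess_ordIso by blast

lemma card_Field_omega1: "|Field omega1| =o omega1"
  by (rule card_of_Field_ordIso[OF Card_order_omega1])

lemma card_eq_omega1:
  assumes "|A| \<le>o omega1" and "uncountable A"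
  shows "|A| =o omega1"
  using assms card_less_omega1_iff ordLeq_iff_ordLess_or_ordIso by blast

lemma card_eq_omega1_subset:
  assumes "A \<subseteq> Field omega1" and "uncountable A"
  shows "|A| =o omega1"
  using assms card_eq_omega1 card_of_mono1 card_Field_omega1 ordLeq_ordIso_trans by blast

lemma countable_under_omega1: "countable (under omega1 a)"
proof (cases "a \<in> Field omega1")
  case True
  have "|underS omega1 a| <o omega1"
    by (rule card_of_underS[OF Card_order_omega1 True])
  then have "countable (insert a (underS omega1 a))"
    by (simp add: card_less_omega1_iff)
  then show ?thesis
    by (rule countable_subset[rotated]) (auto simp: under_def underS_def)
next
  case False
  then have "under omega1 a = {}"
    by (auto simp: under_def Field_def)
  then show ?thesis by simp
qed

lemma countable_underS_omega1: "countable (underS omega1 a)"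
  using countable_under_omega1 underS_subset_under countable_subset by metis

lemma wf_omega1: "wf (omega1 - Id)"
  using Well_order_omega1 by (simp add: well_order_on_def)

lemma omega1_less_linear:
  assumes "a \<in> Field omega1" "b \<in> Field omega1"
  shows "a \<in> underS omega1 b \<or> a = b \<or> b \<in> underS omega1 a"
  using assms Well_order_omega1
  by (auto simp: well_order_on_def linear_order_on_def total_on_def underS_def)

text \<open>The segments \<open>under omega1 b\<close> for \<open>b\<close> in \<open>B\<close> have
  a countable union, so \<open>J\<close> has a member outside it; by linearity this member lies
  above all of \<open>B\<close>.\<close>

lemma uncountable_unbounded_omega1:
  assumes J: "J \<subseteq> Field omega1" "uncountable J" and B: "B \<subseteq> Field omega1" "countable B"
  obtains a where "a \<in> J" "B \<subseteq> underS omega1 a"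
proof -
  have "countable (\<Union>b\<in>B. under omega1 b)"
    using B countable_under_omega1 by blast
  then obtain a where a: "a \<in> J" "a \<notin> (\<Union>b\<in>B. under omega1 b)"
    using J(2) by (meson countable_subset subsetI)
  have "b \<in> underS omega1 a" if "b \<in> B" for b
  proof -
    have "b \<in> Field omega1" "a \<in> Field omega1" using that a(1) J(1) B(1) by auto
    moreover have "a \<notin> under omega1 b" using a(2) that by blast
    moreover have "b \<in> under omega1 b"
      using Refl_under_in[of omega1 b] \<open>b \<in> Field omega1\<close> Well_order_omega1
      by (simp add: well_order_on_def linear_order_on_def partial_order_on_def preorder_on_def)
    ultimately show ?thesis
      using omega1_less_linear[of a b] by (auto simp: underS_def under_def)
  qed
  with a(1) that show ?thesis by blast
qed

section \<open>Counting countable sets under CH\<close>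

lemma continuum_hypothesis_imp_super_stick:
  assumes "continuum_hypothesis"
  shows "super_stick"
proof -
  let ?F = "Field omega1"
  let ?S = "subsets_less ?F omega1"
  have S: "?S = {B. B \<subseteq> ?F \<and> countable B}"
    by (simp add: subsets_less_def card_less_omega1_iff)
  have CH: "|UNIV :: nat set set| =o omega1"
    using assms by (simp add: continuum_hypothesis_def)
  then have "|UNIV :: nat set set| =o |?F|"
    using card_Field_omega1 ordIso_symmetric ordIso_transitive by blast
  then obtain e :: "nat set \<Rightarrow> nat set" where e: "bij_betw e UNIV ?F"
    using card_of_ordIso by blast
  \<comment> \<open>One set of naturals codes a sequence of such sets; \<open>Suc\<close> keeps 0
    free.\<close>
  define row :: "nat set \<Rightarrow> nat \<Rightarrow> nat set"
    where "row A n = {m. Suc (prod_encode (n, m)) \<in> A}" for A n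
  \<comment> \<open>\<open>0 \<in> A\<close> is a flag for the empty set, the only countable set that is not the range of a sequence.\<close>
  define dec where "dec A = (if 0 \<in> A then {} else e ` range (row A))" for A
  have "B \<in> range dec" if B: "B \<subseteq> ?F" "countable B" for B
  proof (cases "B = {}")
    case True
    then have "B = dec {0}" by (simp add: dec_def)
    then show ?thesis by blast
  next
    case False
    with B(2) obtain q :: "nat \<Rightarrow> nat set" where q: "B = range q"
      using uncountable_def by blast
    define p where "p = inv e \<circ> q"
    have p: "q n = e (p n)" for n
    proof -
      have "q n \<in> range e"
        using q B(1) bij_betw_imp_surj_on[OF e] by blast
      then show ?thesis by (simp add: p_def f_inv_into_f)
    qed
    let ?A = "{Suc (prod_encode (n, m)) | n m. m \<in> p n}"
    have "row ?A = p"
      by (auto simp: row_def fun_eq_iff)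
    then have "B = dec ?A"
      using q p by (auto simp: dec_def image_image)
    then show ?thesis by blast
  qed
  then have "?S \<subseteq> range dec" unfolding S by blast
  then have "|?S| \<le>o |UNIV :: nat set set|"
    by (rule surj_imp_ordLeq)
  then have "|?S| \<le>o omega1"
    using CH ordLeq_ordIso_trans by blast
  moreover have "uncountable ?S"
  proof
    assume "countable ?S"
    moreover have "(\<lambda>a. {a}) ` ?F \<subseteq> ?S" by (auto simp: S)
    ultimately have "countable ((\<lambda>a. {a}) ` ?F)" using countable_subset by blast
    then have "countable ?F" by (rule countable_image_inj_on) simp
    then show False using uncountable_if_card_eq_omega1[OF card_Field_omega1] by blast
  qed
  ultimately have card_S: "|?S| =o omega1" by (rule card_eq_omega1)
  show ?thesis
    unfolding super_stick_def
  proof (intro exI[of _ ?S] conjI ballI subset_refl card_S)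
    fix I assume I: "I \<in> subsets_eq ?F omega1"
    show "\<exists>J \<in> subsets_eq I omega1. \<forall>T \<in> subsets_less J omega1. \<exists>S \<in> ?S. T \<subseteq> S \<and> S \<subseteq> I"
    proof (rule bexI[of _ I], rule ballI)
      fix T assume "T \<in> subsets_less I omega1"
      with I show "\<exists>S \<in> ?S. T \<subseteq> S \<and> S \<subseteq> I"
        by (intro bexI[of _ T]) (auto simp: subsets_eq_def subsets_less_def)
    qed (use I in \<open>simp add: subsets_eq_def\<close>)
  qed
qed

text \<open>Passes from points to indices: as \<open>x\<close> is injective on \<open>A\<close>,
  \<open>V\<close> induces a well-defined assignment on the points, and an uncountable set of points
  pulls back to an uncountable set of indices.\<close>

lemma C_omega1_family:
  assumes X: "C_omega1 X" and A: "A \<subseteq> Field omega1" "uncountable A" and inj: "inj_on x A"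
    and V: "\<And>a. a \<in> A \<Longrightarrow> openin X (V a)" "\<And>a. a \<in> A \<Longrightarrow> x a \<in> V a"
  obtains B where "B \<subseteq> A" "uncountable B" "\<And>a b. a \<in> B \<Longrightarrow> b \<in> B \<Longrightarrow> x b \<in> V a"
proof -
  define U where
    "U y = (if y \<in> x ` A then Some (V (the_inv_into A x y)) else None)" for y
  have dom: "dom U = x ` A" by (auto simp: U_def dom_def)
  have U: "the (U (x a)) = V a" if "a \<in> A" for a
    using that inj by (simp add: U_def the_inv_into_f_f)
  have "partial_nbhd_assignment X U"
    unfolding partial_nbhd_assignment_def dom
    using V openin_subset U by fastforce
  moreover have "|dom U| =o omega1"
    unfolding dom using card_eq_omega1_subset[OF A] card_of_ordIso[of A "x ` A"] inj
    by (meson inj_on_imp_bij_betw ordIso_symmetric ordIso_transitive)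
  ultimately obtain Y where Y: "Y \<subseteq> x ` A" "|Y| =o omega1" "Y \<subseteq> (\<Inter>y\<in>Y. the (U y))"
    using X unfolding C_omega1_def subsets_eq_def dom[symmetric] by blast
  let ?B = "{a \<in> A. x a \<in> Y}"
  have "Y = x ` ?B" using Y(1) by blast
  then have "uncountable ?B"
    using uncountable_if_card_eq_omega1[OF Y(2)] by (metis countable_image)
  moreover have "x b \<in> V a" if "a \<in> ?B" "b \<in> ?B" for a b
    using that Y(3) U[of a] by auto
  ultimately show ?thesis using that[of ?B] by blast
qed

text \<open>
  The indices \<open>a \<in> J\<close> whose point lies outside the closure of its predecessors form a left-separated
  family, which \<open>C(\<omega>\<^sub>1)\<close> forces to be countable; by well-founded induction it is dense.
\<close>
lemma C_omega1_countable_dense: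
  assumes X: "C_omega1 X" and J: "J \<subseteq> Field omega1" and inj: "inj_on x J"
    and x: "x ` J \<subseteq> topspace X"
  obtains T where "T \<subseteq> J" "countable T" "x ` J \<subseteq> X closure_of (x ` T)"
proof -
  define P where "P a = X closure_of (x ` (J \<inter> underS omega1 a))" for a
  define T where "T = {a \<in> J. x a \<notin> P a}"
  have "countable T"
  proof (rule ccontr)
    assume "uncountable T"
    have T: "T \<subseteq> Field omega1" "inj_on x T"
      using J inj by (auto simp: T_def inj_on_def)
    have op: "openin X (topspace X - P a)" for a
      by (simp add: P_def openin_diff)
    have mem: "x a \<in> topspace X - P a" if "a \<in> T" for a
      using that x by (auto simp: T_def)
    obtain B where B: "B \<subseteq> T" "uncountable B"
      "\<And>a b. a \<in> B \<Longrightarrow> b \<in> B \<Longrightarrow> x b \<in> topspace X - P a"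
      using C_omega1_family[OF X T(1) \<open>uncountable T\<close> T(2) op mem] by metis
    from B(2) obtain b where b: "b \<in> B"
      by (metis countable_empty ex_in_conv)
    have "B \<subseteq> Field omega1" using B(1) T(1) by blast
    \<comment> \<open>As \<open>b\<close> precedes \<open>a\<close>, the point \<open>x b\<close>
      lies in \<open>P a\<close>, which the neighbourhood at \<open>a\<close> omits.\<close>
    then obtain a where a: "a \<in> B" "{b} \<subseteq> underS omega1 a"
      using uncountable_unbounded_omega1[OF _ B(2), of "{b}"] b by auto
    have "x b \<in> x ` (J \<inter> underS omega1 a)"
      using a b B(1) by (auto simp: T_def)
    moreover have "x ` (J \<inter> underS omega1 a) \<subseteq> topspace X" using x by auto
    ultimately have "x b \<in> P a"
      unfolding P_def by (meson closure_of_subset subsetD)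
    with B(3)[OF a(1) b] show False by blast
  qed
  moreover have "a \<in> J \<longrightarrow> x a \<in> X closure_of (x ` T)" for a
  proof (induction a rule: wf_induct_rule[OF wf_omega1])
    case (1 a)
    show ?case
    proof
      assume a: "a \<in> J"
      show "x a \<in> X closure_of (x ` T)"
      proof (cases "a \<in> T")
        case True
        moreover have "x ` T \<subseteq> topspace X" using x by (auto simp: T_def)
        ultimately show ?thesis
          by (meson closure_of_subset image_eqI subsetD)
      next
        case False
        \<comment> \<open>The earlier points lie in a closed set, hence so does their closure
          \<open>P a\<close>.\<close>
        have "x ` (J \<inter> underS omega1 a) \<subseteq> X closure_of (x ` T)"
          using 1 by (auto simp: underS_def)
        then have "P a \<subseteq> X closure_of (x ` T)"
          unfolding P_def by (simp add: closure_of_minimal)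
        with False a show ?thesis by (auto simp: T_def)
      qed
    qed
  qed
  ultimately show ?thesis using that[of T] by (auto simp: T_def)
qed

text \<open>At each stage the earlier closures and singletons are countably many, so they form no
  network; a point and an open set witnessing this are the next choice.\<close>

lemma no_countable_network_recursion:
  assumes X: "\<And>\<N>. network_of X \<N> \<Longrightarrow> uncountable \<N>"
  obtains x :: "nat set \<Rightarrow> 'a" and U where
    "\<And>a. openin X (U a)" "\<And>a. x a \<in> U a" "inj_on x (Field omega1)"
    "\<And>a b. \<lbrakk>b \<in> underS omega1 a; G b \<subseteq> underS omega1 a;
      x a \<in> X closure_of (x ` G b)\<rbrakk> \<Longrightarrow> \<not> X closure_of (x ` G b) \<subseteq> U a"
proof -
  \<comment> \<open>The intersection makes the requirement at \<open>a\<close> depend only on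
    earlier values of \<open>f\<close>, as the recursion demands; it changes nothing once
    \<open>G b\<close> lies below \<open>a\<close>.\<close>
  define C where "C f a b = X closure_of ((fst \<circ> f) ` (G b \<inter> underS omega1 a))"
    for f :: "nat set \<Rightarrow> 'a \<times> 'a set" and a b
  define P where "P f a r \<longleftrightarrow> openin X (snd r) \<and> fst r \<in> snd r \<and>
      (\<forall>b\<in>underS omega1 a. fst r \<noteq> fst (f b) \<and> \<not> (fst r \<in> C f a b \<and> C f a b \<subseteq> snd r))"
    for f a r
  have "\<exists>f. \<forall>a. P f a (f a)"
  proof (rule dependent_wf_choice[OF wf_omega1])
    fix f g :: "nat set \<Rightarrow> 'a \<times> 'a set" and a r
    assume "\<And>z. (z, a) \<in> omega1 - Id \<Longrightarrow> f z = g z"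
    then have eq: "f z = g z" if "z \<in> underS omega1 a" for z
      using that by (auto simp: underS_def)
    then have "C f a b = C g a b" for b
      unfolding C_def by (intro arg_cong[of _ _ "(closure_of) X"] image_cong) auto
    with eq show "P f a r = P g a r"
      by (simp add: P_def)
  next
    fix a and f :: "nat set \<Rightarrow> 'a \<times> 'a set"
    \<comment> \<open>The singletons keep the points distinct. They are cut with the space because
      \<open>f\<close> is arbitrary here and may take values outside it.\<close>
    define \<N> where "\<N> = C f a ` underS omega1 a \<union>
      (\<lambda>b. topspace X \<inter> {fst (f b)}) ` underS omega1 a"
    have "countable \<N>"
      by (simp add: \<N>_def countable_underS_omega1)
    then have "\<not> network_of X \<N>" using X by blast
    moreover have "\<N> \<subseteq> Pow (topspace X)"
      by (auto simp: \<N>_def C_def dest: subsetD[OF closure_of_subset_topspace])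
    ultimately have "\<exists>U x. openin X U \<and> x \<in> U \<and> (\<forall>N\<in>\<N>. \<not> (x \<in> N \<and> N \<subseteq> U))"
      unfolding network_of_def by meson
    then obtain U x where U: "openin X U" "x \<in> U" "\<And>N. N \<in> \<N> \<Longrightarrow> \<not> (x \<in> N \<and> N \<subseteq> U)"
      by meson
    have "x \<noteq> fst (f b)" if "b \<in> underS omega1 a" for b
      using U(3)[of "topspace X \<inter> {fst (f b)}"] U(1,2) that openin_subset by (auto simp: \<N>_def)
    then have "P f a (x, U)"
      using U by (auto simp: P_def \<N>_def)
    then show "\<exists>r. P f a r" ..
  qed
  then obtain f where f: "\<And>a. P f a (f a)" by blast
  show ?thesis
  proof (rule that[of "snd \<circ> f" "fst \<circ> f"])
    show "openin X ((snd \<circ> f) a)" "(fst \<circ> f) a \<in> (snd \<circ> f) a" for a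
      using f[of a] by (auto simp: P_def)
    show "inj_on (fst \<circ> f) (Field omega1)"
      using f omega1_less_linear unfolding inj_on_def P_def o_def by metis
    fix a b
    assume ab: "b \<in> underS omega1 a" "G b \<subseteq> underS omega1 a"
      "(fst \<circ> f) a \<in> X closure_of ((fst \<circ> f) ` G b)"
    have "C f a b = X closure_of ((fst \<circ> f) ` G b)"
      using ab(2) by (simp add: C_def Int_absorb2)
    with ab(1,3) f[of a] show "\<not> X closure_of ((fst \<circ> f) ` G b) \<subseteq> (snd \<circ> f) a"
      unfolding P_def comp_apply by metis
  qed
qed

section \<open>Super stick against the recursive choice\<close>

lemma super_stick_imp_countable_network:
  fixes X :: "'a topology"
  assumes stick: "super_stick" and reg: "regular_space X" and X: "C_omega1 X"
  shows "\<exists>\<N>. network_of X \<N> \<and> countable \<N>"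
proof (rule ccontr)
  let ?F = "Field omega1"
  assume "\<nexists>\<N>. network_of X \<N> \<and> countable \<N>"
  then have no_network: "\<And>\<N>. network_of X \<N> \<Longrightarrow> uncountable \<N>" by blast
  obtain \<S> where \<S>: "\<S> \<subseteq> subsets_less ?F omega1" "|\<S>| =o omega1"
    and stick': "\<And>I. I \<in> subsets_eq ?F omega1 \<Longrightarrow> \<exists>J \<in> subsets_eq I omega1.
          \<forall>T \<in> subsets_less J omega1. \<exists>S \<in> \<S>. T \<subseteq> S \<and> S \<subseteq> I"
    using stick[unfolded super_stick_def] by (elim exE conjE) metis
  obtain G where G: "bij_betw G ?F \<S>"
    using card_of_ordIso[of ?F \<S>] card_Field_omega1 \<S>(2)
    by (meson ordIso_symmetric ordIso_transitive)
  obtain x :: "nat set \<Rightarrow> 'a" and U where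
    U: "\<And>a. openin X (U a)" "\<And>a. x a \<in> U a" and inj: "inj_on x ?F" and
    avoid: "\<And>a b. \<lbrakk>b \<in> underS omega1 a; G b \<subseteq> underS omega1 a;
      x a \<in> X closure_of (x ` G b)\<rbrakk> \<Longrightarrow> \<not> X closure_of (x ` G b) \<subseteq> U a"
    using no_countable_network_recursion[OF no_network, where G = G] by metis
  have x: "x a \<in> topspace X" for a
    using U openin_subset by blast
  have "\<exists>V. openin X V \<and> x a \<in> V \<and> X closure_of V \<subseteq> U a" for a
    using reg U[of a] unfolding neighbourhood_base_of_closedin[symmetric] neighbourhood_base_of
    by (meson closure_of_minimal order_trans)
  then obtain V where V: "\<And>a. openin X (V a)" "\<And>a. x a \<in> V a"
    "\<And>a. X closure_of (V a) \<subseteq> U a" by metis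
  \<comment> \<open>With \<open>V\<close> in place of \<open>U\<close>, even closures of sets of
    points indexed in \<open>I\<close> stay inside \<open>U a\<close>.\<close>
  obtain I where I: "I \<subseteq> ?F" "uncountable I" "\<And>a b. a \<in> I \<Longrightarrow> b \<in> I \<Longrightarrow> x b \<in> V a"
    using C_omega1_family[OF X subset_refl uncountable_if_card_eq_omega1[OF card_Field_omega1] inj V(1,2)]
    by metis
  obtain J where J: "J \<subseteq> I" "|J| =o omega1"
    "\<And>T. T \<subseteq> J \<Longrightarrow> countable T \<Longrightarrow> \<exists>S \<in> \<S>. T \<subseteq> S \<and> S \<subseteq> I"
    using stick'[of I] I(1) card_eq_omega1_subset[OF I(1,2)]
    unfolding subsets_eq_def subsets_less_def by (auto simp: card_less_omega1_iff)
  have J': "J \<subseteq> ?F" "uncountable J"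
    using J(1) I(1) uncountable_if_card_eq_omega1[OF J(2)] by simp_all
  obtain T where T: "T \<subseteq> J" "countable T" "x ` J \<subseteq> X closure_of (x ` T)"
    using C_omega1_countable_dense[OF X J'(1) inj_on_subset[OF inj J'(1)]] x by blast
  obtain b where b: "b \<in> ?F" "T \<subseteq> G b" "G b \<subseteq> I"
    using J(3)[OF T(1,2)] G by (metis bij_betw_imp_surj_on imageE)
  have "countable (G b)"
    using \<S>(1) G b(1) by (auto simp: subsets_less_def card_less_omega1_iff dest: bij_betwE)
  then have "insert b (G b) \<subseteq> ?F" "countable (insert b (G b))"
    using b I(1) by auto
  \<comment> \<open>\<open>avoid\<close> applies at \<open>a\<close> only if both \<open>b\<close>
    and all members of \<open>G b\<close> precede \<open>a\<close>; hence \<open>b\<close> is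
    inserted.\<close>
  then obtain a where a: "a \<in> J" "insert b (G b) \<subseteq> underS omega1 a"
    using uncountable_unbounded_omega1[OF J'] by metis
  have "x a \<in> X closure_of (x ` G b)"
    using T(3) a(1) closure_of_mono[OF image_mono[OF b(2), of x], of X] by blast
  moreover have "x ` G b \<subseteq> V a"
    using I(3) b(3) a(1) J(1) by blast
  then have "X closure_of (x ` G b) \<subseteq> U a"
    using closure_of_mono V(3) by (meson order_trans)
  ultimately show False
    using avoid[of b a] a(2) by blast
qed

theorem theorem1p5:
  shows "(continuum_hypothesis \<longrightarrow> super_stick) \<and>
    (super_stick \<longrightarrow>
      (\<forall>X :: 'a topology. T3_space X \<and> C_omega1 X \<longrightarrow> nw X =o natLeq))"
  using continuum_hypothesis_imp_super_stick super_stick_imp_countable_network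
  by (auto simp: T3_space_def nw_eq_natLeq_iff)

end
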